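(* Let $\Omega\subset\mathbb R^N$ be a bounded open set and let $R$ be the radius of the largest ball contained in $\Omega$. Let $F$ satisfy the structure conditions in the context, with constants $0<a\le A$ and exponent $\alpha>-1$. Then there exists a constant $C$ depending only on $a$, $A$, $N$ and $\alpha$ such that $$\bar\lambda\le\frac{C}{R^{\alpha+2}}.$$
   Context: Operator: $S$ is the set of real symmetric $N\times N$ matrices with the usual order, and $F:(\mathbb R^N\setminus\{0\})\times S\to\mathbb R$ satisfies: (i) $F(tp,\mu X)=|t|^\alpha\mu F(p,X)$ for all $t\in\mathbb R\setminus\{0\}$, $\mu>0$, $p\ne0$, $X\in S$; (ii) $a|p|^\alpha\,\mathrm{tr}\,Z\le F(p,M+Z)-F(p,M)\le A|p|^\alpha\,\mathrm{tr}\,Z$ for all $p\neq0$, $M,Z\in S$ with $Z\ge0$. Viscosity super-solution: for bounded $v$ on $\overline\Omega$ put $v_\star(x)=\lim_{r\to0}\inf\{v(y):y\in\overline\Omega,|y-x|\le r\}$. Then $v$ is a viscosity super-solution of $F(\nabla v,D^2v)=g(x,v)$ in $\Omega$ (written $F(\nabla v,D^2v)\le g(x,v)$) if for every $x_0\in\Omega$: if $v$ is constant, equal to $c$, on some ball $B(x_0,\delta)\subset\Omega$, then $g(x,c)\ge 0$ on that ball; otherwise, for every $\varphi\in\mathcal C^2(\Omega)$ such that $v_\star-\varphi$ has a local minimum at $x_0$ and $\nabla\varphi(x_0)\ne0$, one has $F(\nabla\varphi(x_0),D^2\varphi(x_0))\le g(x_0,v_\star(x_0))$. Definition of $\bar\lambda$: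 $\bar\lambda=\sup E$, where $E$ is the set of $\lambda\in\mathbb R$ for which there exists $\phi$ with $\phi_\star>0$ in $\Omega$ and $F(\nabla\phi,D^2\phi)+\lambda\phi^{\alpha+1}\le0$ in $\Omega$ in the viscosity sense (i.e. with $g(x,s)=-\lambda|s|^\alpha s$).
   Formalization: In the super-solution definition, "v is constant on a ball" is read for the envelope v_⋆ instead of v; read literally, v = 1 + indicator of a dense set with dense complement is a super-solution for every λ, so λ̄ = +∞ and the bound fails. *)

theory Defs
  imports "HOL-Analysis.Analysis"
begin

definition symmetric_matrix :: "real ^ 'n ^ 'n \<Rightarrow> bool" where
  "symmetric_matrix X \<longleftrightarrow> transpose X = X"

definition nonneg_matrix :: "real ^ 'n ^ 'n \<Rightarrow> bool" where
  "nonneg_matrix Z \<longleftrightarrow> symmetric_matrix Z \<and> (\<forall>\<xi>. 0 \<le> \<xi> \<bullet> (Z *v \<xi>))"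

text \<open>
  The operator is a total function, but only its values at nonzero vectors and symmetric
  matrices are constrained below, and only those values are ever used (Hessians of
  \<open>C\<^sup>2\<close> functions are symmetric).
\<close>

definition structure_conditions ::
  "real \<Rightarrow> real \<Rightarrow> real \<Rightarrow> (real ^ 'n \<Rightarrow> real ^ 'n ^ 'n \<Rightarrow> real) \<Rightarrow> bool" where
  "structure_conditions a A \<alpha> F \<longleftrightarrow>
     (\<forall>t \<mu> p X. t \<noteq> 0 \<longrightarrow> \<mu> > 0 \<longrightarrow> p \<noteq> 0 \<longrightarrow> symmetric_matrix X \<longrightarrow>
        F (t *\<^sub>R p) (\<mu> *\<^sub>R X) = \<bar>t\<bar> powr \<alpha> * \<mu> * F p X) \<and>
     (\<forall>p M Z. p \<noteq> 0 \<longrightarrow> symmetric_matrix M \<longrightarrow> nonneg_matrix Z \<longrightarrow>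
        a * norm p powr \<alpha> * trace Z \<le> F p (M + Z) - F p M \<and>
        F p (M + Z) - F p M \<le> A * norm p powr \<alpha> * trace Z)"

definition grad :: "(real ^ 'n \<Rightarrow> real) \<Rightarrow> real ^ 'n \<Rightarrow> real ^ 'n" where
  "grad \<phi> x = (\<chi> i. frechet_derivative \<phi> (at x) (axis i 1))"

definition hess :: "(real ^ 'n \<Rightarrow> real) \<Rightarrow> real ^ 'n \<Rightarrow> real ^ 'n ^ 'n" where
  "hess \<phi> x = jacobian (grad \<phi>) (at x)"

text \<open>Only meaningful for open sets.\<close>

definition C2_on :: "(real ^ 'n) set \<Rightarrow> (real ^ 'n \<Rightarrow> real) \<Rightarrow> bool" where
  "C2_on \<Omega> \<phi> \<longleftrightarrow>
     (\<forall>x\<in>\<Omega>. \<phi> differentiable (at x)) \<and>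
     (\<forall>x\<in>\<Omega>. grad \<phi> differentiable (at x)) \<and>
     continuous_on \<Omega> (hess \<phi>)"

definition lsc_env :: "(real ^ 'n) set \<Rightarrow> (real ^ 'n \<Rightarrow> real) \<Rightarrow> real ^ 'n \<Rightarrow> real" where
  "lsc_env \<Omega> v x = Lim (at_right 0) (\<lambda>r. INF y\<in>closure \<Omega> \<inter> cball x r. v y)"

text \<open>
  Super-solutions, as all viscosity notions, see \<open>v\<close> only through its envelope \<open>v\<^sub>\<star>\<close>; the
  clause for locally constant functions is therefore read for \<open>v\<^sub>\<star>\<close> as well (if \<open>v\<close> equals \<open>c\<close>
  on a ball, so does \<open>v\<^sub>\<star>\<close>).  Read for \<open>v\<close> itself, it would be void for
  \<open>v = 1 + indicator D\<close> with \<open>D\<close> dense with dense complement: \<open>v\<close> is constant on no ball, while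
  \<open>v\<^sub>\<star>\<close> is constant and so has no test function with nonzero gradient.
  Every such \<open>v\<close> would be a super-solution of every equation.
\<close>

definition viscosity_supersolution ::
  "(real ^ 'n \<Rightarrow> real ^ 'n ^ 'n \<Rightarrow> real) \<Rightarrow> (real ^ 'n \<Rightarrow> real \<Rightarrow> real) \<Rightarrow>
   (real ^ 'n) set \<Rightarrow> (real ^ 'n \<Rightarrow> real) \<Rightarrow> bool" where
  "viscosity_supersolution F g \<Omega> v \<longleftrightarrow>
     bounded (v ` closure \<Omega>) \<and>
     (\<forall>x\<^sub>0\<in>\<Omega>.
        (\<forall>\<delta> c. \<delta> > 0 \<longrightarrow> ball x\<^sub>0 \<delta> \<subseteq> \<Omega> \<longrightarrow> (\<forall>y\<in>ball x\<^sub>0 \<delta>. lsc_env \<Omega> v y = c) \<longrightarrow>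
           (\<forall>x\<in>ball x\<^sub>0 \<delta>. g x c \<ge> 0)) \<and>
        (\<not> (\<exists>\<delta> c. \<delta> > 0 \<and> ball x\<^sub>0 \<delta> \<subseteq> \<Omega> \<and> (\<forall>y\<in>ball x\<^sub>0 \<delta>. lsc_env \<Omega> v y = c)) \<longrightarrow>
           (\<forall>\<phi>. C2_on \<Omega> \<phi> \<longrightarrow>
              (\<forall>\<^sub>F y in nhds x\<^sub>0. lsc_env \<Omega> v x\<^sub>0 - \<phi> x\<^sub>0 \<le> lsc_env \<Omega> v y - \<phi> y) \<longrightarrow>
              grad \<phi> x\<^sub>0 \<noteq> 0 \<longrightarrow>
              F (grad \<phi> x\<^sub>0) (hess \<phi> x\<^sub>0) \<le> g x\<^sub>0 (lsc_env \<Omega> v x\<^sub>0))))"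

definition admissible_lambdas ::
  "(real ^ 'n \<Rightarrow> real ^ 'n ^ 'n \<Rightarrow> real) \<Rightarrow> real \<Rightarrow> (real ^ 'n) set \<Rightarrow> real set" where
  "admissible_lambdas F \<alpha> \<Omega> =
     {\<mu>. \<exists>\<phi>. (\<forall>x\<in>\<Omega>. lsc_env \<Omega> \<phi> x > 0) \<and>
        viscosity_supersolution F (\<lambda>x s. - \<mu> * \<bar>s\<bar> powr \<alpha> * s) \<Omega> \<phi>}"

text \<open>
  The supremum is taken in the extended reals, so that an upper bound on it includes the
  statement that the set is bounded above.
\<close>

definition lambda_bar ::
  "(real ^ 'n \<Rightarrow> real ^ 'n ^ 'n \<Rightarrow> real) \<Rightarrow> real \<Rightarrow> (real ^ 'n) set \<Rightarrow> ereal" where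
  "lambda_bar F \<alpha> \<Omega> = (SUP \<mu>\<in>admissible_lambdas F \<alpha> \<Omega>. ereal \<mu>)"

text \<open>For nonempty bounded open \<open>\<Omega>\<close> the supremum is attained: it is the radius of a largest ball.\<close>

definition inradius :: "(real ^ 'n) set \<Rightarrow> real" where
  "inradius \<Omega> = Sup {r. r > 0 \<and> (\<exists>x. ball x r \<subseteq> \<Omega>)}"

end

theory Submission
  imports Defs
begin

text \<open>
  Let \<open>v\<close> be the envelope of a positive super-solution and let \<open>h\<close> be close to the centre of a ball
  in \<open>\<Omega>\<close>. The test function is a multiple of the bump \<open>\<psi>(x) = (1 - (\<bar>x - h\<bar> / r) ^ (2n + 2))\<^sup>2\<close>, lifted
  until it touches \<open>v\<close> from below in the ball of radius \<open>r\<close> about \<open>h\<close>, that is, where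
  \<open>\<psi> / v\<close> is maximal. Since \<open>\<psi>\<close> vanishes on the boundary, the contact point is interior. The equation
  and the homogeneity of \<open>F\<close> give \<open>\<mu> \<psi> powr (\<alpha> + 1) \<le> - F (\<nabla>\<psi>) (D\<^sup>2\<psi>)\<close> there, provided \<open>\<nabla>\<psi> \<noteq> 0\<close>.
  The exponent is chosen large enough for \<open>\<psi>\<close> to be \<open>C\<^sup>2\<close> and for the right-hand side to stay bounded
  at the centre when \<open>\<alpha> < 0\<close>, while the square makes it nonpositive near the boundary.

  The gradient vanishes only if the contact point is \<open>h\<close> itself. If that happens for all \<open>h\<close> in a small
  ball, then \<open>v h - v x \<le> K \<bar>x - h\<bar>\<^sup>2\<close> for all \<open>x\<close>, \<open>h\<close> in it, so \<open>v\<close> is locally constant,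
  and the clause for locally constant functions gives \<open>\<mu> \<le> 0\<close>.
\<close>

section \<open>The lower semicontinuous envelope\<close>

lemma Lim_at_right_antimono_ge:
  fixes f :: "real \<Rightarrow> real"
  assumes mono: "\<And>r s. 0 < r \<Longrightarrow> r \<le> s \<Longrightarrow> f s \<le> f r" and bound: "\<And>r. 0 < r \<Longrightarrow> f r \<le> M"
  shows "(f \<longlongrightarrow> (SUP r\<in>{0<..}. f r)) (at_right 0)"
proof (rule increasing_tendsto)
  have bdd: "bdd_above (f ` {0<..})" using bound by (auto intro!: bdd_aboveI[of _ M])
  show "\<forall>\<^sub>F r in at_right 0. f r \<le> (SUP r\<in>{0<..}. f r)"
    by (auto simp: eventually_at_right_less intro!: eventually_mono[OF eventually_at_right_less] cSUP_upper bdd)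
  fix t assume "t < (SUP r\<in>{0<..}. f r)"
  then obtain r where r: "r > 0" "t < f r"
    using less_cSUP_iff[OF _ bdd, of t] by (auto intro: exI[of _ 1])
  show "\<forall>\<^sub>F x in at_right 0. t < f x"
    using eventually_at_right_real[OF r(1)]
  proof eventually_elim
    case (elim x)
    then show ?case using mono[of x r] r by simp
  qed
qed

locale bounded_on_closure =
  fixes \<Omega> :: "(real ^ 'n) set" and \<phi> :: "real ^ 'n \<Rightarrow> real"
  assumes bdd: "bounded (\<phi> ` closure \<Omega>)"
begin

lemma bdd_below_image: "bdd_below (\<phi> ` (closure \<Omega> \<inter> B))"
  using bounded_imp_bdd_below[OF bdd] by (rule bdd_below_mono) auto

lemma INF_cball_antimono:
  assumes "x \<in> closure \<Omega>" "cball x r \<subseteq> cball y s" "0 \<le> r"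
  shows "(INF z\<in>closure \<Omega> \<inter> cball y s. \<phi> z) \<le> (INF z\<in>closure \<Omega> \<inter> cball x r. \<phi> z)"
  by (rule cINF_superset_mono) (use assms bdd_below_image in auto)

lemma INF_cball_le: "x \<in> closure \<Omega> \<Longrightarrow> 0 < r \<Longrightarrow> (INF z\<in>closure \<Omega> \<inter> cball x r. \<phi> z) \<le> \<phi> x"
  by (rule cINF_lower) (use bdd_below_image in auto)

text \<open>\<open>Lim\<close> is informative only once convergence is known. The infima grow as the
  radius shrinks and stay below \<open>\<phi> x\<close>, so they converge to their supremum.\<close>

lemma lsc_env_eq_SUP:
  assumes "x \<in> closure \<Omega>"
  shows "lsc_env \<Omega> \<phi> x = (SUP r\<in>{0<..}. INF y\<in>closure \<Omega> \<inter> cball x r. \<phi> y)"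
  unfolding lsc_env_def
proof (rule tendsto_Lim[OF trivial_limit_at_right_real], rule Lim_at_right_antimono_ge)
  show "(INF y\<in>closure \<Omega> \<inter> cball x s. \<phi> y) \<le> (INF y\<in>closure \<Omega> \<inter> cball x r. \<phi> y)"
    if "0 < r" "r \<le> s" for r s
    by (rule INF_cball_antimono) (use assms that in auto)
qed (rule INF_cball_le[OF assms])

lemma bdd_above_INF:
  assumes "x \<in> closure \<Omega>"
  shows "bdd_above ((\<lambda>r. INF y\<in>closure \<Omega> \<inter> cball x r. \<phi> y) ` {0<..})"
  using INF_cball_le[OF assms] by (auto intro!: bdd_aboveI[of _ "\<phi> x"])

lemma lsc_env_le:
  assumes "x \<in> closure \<Omega>"
  shows "lsc_env \<Omega> \<phi> x \<le> \<phi> x"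
  unfolding lsc_env_eq_SUP[OF assms]
  by (rule cSUP_least) (use INF_cball_le[OF assms] in \<open>auto intro: exI[of _ 1]\<close>)

text \<open>If the infimum over the ball of radius \<open>r\<close> about \<open>x\<close> exceeds
  \<open>t\<close>, then \<open>r/2\<close> serves as \<open>d\<close>: the balls of radius
  \<open>r/2\<close> about nearby points lie inside that ball.\<close>

lemma lsc_env_lsc:
  assumes "x \<in> closure \<Omega>" "t < lsc_env \<Omega> \<phi> x"
  obtains d where "d > 0" "\<And>y. y \<in> closure \<Omega> \<Longrightarrow> dist x y < d \<Longrightarrow> t < lsc_env \<Omega> \<phi> y"
proof -
  have "\<exists>r\<in>{0<..}. t < (INF y\<in>closure \<Omega> \<inter> cball x r. \<phi> y)"
    using assms less_cSUP_iff[OF _ bdd_above_INF[OF assms(1)], of t]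
    by (auto simp: lsc_env_eq_SUP)
  then obtain r where r: "r > 0" "t < (INF y\<in>closure \<Omega> \<inter> cball x r. \<phi> y)" by auto
  show thesis
  proof (rule that[of "r/2"])
    fix y assume y: "y \<in> closure \<Omega>" "dist x y < r/2"
    have sub: "cball y (r/2) \<subseteq> cball x r"
    proof
      fix z assume "z \<in> cball y (r/2)"
      then show "z \<in> cball x r" using y dist_triangle[of x z y] by auto
    qed
    have "t < (INF z\<in>closure \<Omega> \<inter> cball x r. \<phi> z)" by fact
    also have "\<dots> \<le> (INF z\<in>closure \<Omega> \<inter> cball y (r/2). \<phi> z)"
      by (rule INF_cball_antimono) (use y assms sub r in auto)
    also have "\<dots> \<le> lsc_env \<Omega> \<phi> y"
      unfolding lsc_env_eq_SUP[OF y(1)]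
      by (rule cSUP_upper[OF _ bdd_above_INF[OF y(1)]]) (use r in auto)
    finally show "t < lsc_env \<Omega> \<phi> y" .
  qed (use r in auto)
qed

end

section \<open>Maxima of semicontinuous functions and local constancy\<close>

text \<open>Without a maximiser every \<open>x\<close> is beaten by some \<open>z x\<close>, even on
  a neighbourhood of \<open>x\<close>. Finitely many neighbourhoods cover \<open>K\<close>, and the
  best of the finitely many points \<open>z x\<close> lies in one of them, hence is beaten by
  another: a contradiction.\<close>

lemma usc_attains_sup:
  fixes g :: "'a::metric_space \<Rightarrow> real"
  assumes K: "compact K" "K \<noteq> {}"
    and usc: "\<And>x t. x \<in> K \<Longrightarrow> g x < t \<Longrightarrow> \<exists>d>0. \<forall>y\<in>K. dist x y < d \<longrightarrow> g y < t"
  shows "\<exists>x\<in>K. \<forall>y\<in>K. g y \<le> g x"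
proof (rule ccontr)
  assume "\<not> ?thesis"
  then have "\<forall>x\<in>K. \<exists>z\<in>K. g x < g z" by (meson not_le)
  then obtain z where z: "\<And>x. x \<in> K \<Longrightarrow> z x \<in> K" "\<And>x. x \<in> K \<Longrightarrow> g x < g (z x)" by metis
  have "\<forall>x\<in>K. \<exists>d>0. \<forall>y\<in>K. dist x y < d \<longrightarrow> g y < g (z x)"
    using usc z(2) by blast
  then obtain d where d: "\<And>x. x \<in> K \<Longrightarrow> d x > 0"
      "\<And>x y. x \<in> K \<Longrightarrow> y \<in> K \<Longrightarrow> dist x y < d x \<Longrightarrow> g y < g (z x)" by metis
  have "K \<subseteq> (\<Union>x\<in>K. ball x (d x))" using d(1) by force
  then obtain D where D: "D \<subseteq> K" "finite D" "K \<subseteq> (\<Union>x\<in>D. ball x (d x))"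
    using compactE_image[OF K(1), of K "\<lambda>x. ball x (d x)"] by auto
  have "D \<noteq> {}" using D(3) K(2) by auto
  then obtain x where x: "x \<in> D" "\<And>w. w \<in> D \<Longrightarrow> g (z w) \<le> g (z x)"
    using obtains_MAX[OF D(2), of "\<lambda>x. g (z x)"] D(2)
    by (metis (no_types, lifting) Max_ge finite_imageI imageI)
  then have "z x \<in> K" using D z by auto
  then obtain w where "w \<in> D" "dist w (z x) < d w" using D(3) by auto
  then have "g (z x) < g (z w)" using d D \<open>z x \<in> K\<close> by blast
  with x \<open>w \<in> D\<close> show False by force
qed

text \<open>Exchanging \<open>x\<close> and \<open>y\<close> makes the bound two-sided, so
  difference quotients are at most \<open>K * norm (y - x)\<close> and the derivative vanishes on a
  convex set.\<close>

lemma constant_on_ball_if_square_modulus: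
  fixes f :: "'a::euclidean_space \<Rightarrow> real"
  assumes "\<And>x y. x \<in> ball z e \<Longrightarrow> y \<in> ball z e \<Longrightarrow> f x - f y \<le> K * (norm (x - y))\<^sup>2"
  shows "\<exists>c. \<forall>y\<in>ball z e. f y = c"
proof (rule has_derivative_zero_constant)
  fix x assume x: "x \<in> ball z e"
  have "((\<lambda>y. norm (f y - f x - 0) / norm (y - x)) \<longlongrightarrow> 0) (at x within ball z e)"
  proof (rule tendsto_sandwich[where f = "\<lambda>_. 0" and h = "\<lambda>y. K * norm (y - x)"])
    show "((\<lambda>y. K * norm (y - x)) \<longlongrightarrow> 0) (at x within ball z e)"
      using x by (auto intro!: tendsto_eq_intros)
    show "\<forall>\<^sub>F y in at x within ball z e. norm (f y - f x - 0) / norm (y - x) \<le> K * norm (y - x)"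
      unfolding eventually_at_filter
    proof (rule always_eventually, intro allI impI)
      fix y assume y: "y \<noteq> x" "y \<in> ball z e"
      have "norm (f y - f x) \<le> K * norm (y - x) ^ 2"
        using assms[OF x y(2)] assms[OF y(2) x] by (simp add: norm_minus_commute abs_le_iff)
      then show "norm (f y - f x - 0) / norm (y - x) \<le> K * norm (y - x)"
        using y by (simp add: divide_le_eq power2_eq_square mult.assoc)
    qed
  qed auto
  then show "(f has_derivative (\<lambda>h. 0)) (at x within ball z e)"
    unfolding has_derivative_iff_norm by (intro conjI bounded_linear_zero)
qed (rule convex_ball)

section \<open>Gradients, Hessians and ellipticity\<close>

lemma grad_eqI:
  assumes "(\<phi> has_derivative (\<lambda>d. g \<bullet> d)) (at x)"
  shows "grad \<phi> x = g"
  unfolding grad_def frechet_derivative_at[OF assms, symmetric]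
  by (simp add: vec_eq_iff inner_axis)

lemma hess_eqI:
  assumes "(grad \<phi> has_derivative (\<lambda>d. H *v d)) (at x)"
  shows "hess \<phi> x = H"
  unfolding hess_def jacobian_def frechet_derivative_at[OF assms, symmetric] by simp

definition outer :: "real ^ 'n \<Rightarrow> real ^ 'n ^ 'n" where
  "outer y = (\<chi> i j. y $ i * y $ j)"

lemma outer_vector_mult: "outer y *v d = (y \<bullet> d) *\<^sub>R y"
  by (simp add: outer_def vec_eq_iff matrix_vector_mult_def inner_vec_def sum_distrib_right
      sum_distrib_left mult_ac)

lemma trace_outer: "trace (outer y) = y \<bullet> y"
  by (simp add: trace_def outer_def inner_vec_def)

lemma trace_scaleR: "trace (c *\<^sub>R (M :: real ^ 'n ^ 'n)) = c * trace M"
  by (simp add: trace_def sum_distrib_left)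

lemma nonneg_matrix_outer: "nonneg_matrix (outer y)"
  by (auto simp: nonneg_matrix_def symmetric_matrix_def outer_vector_mult inner_commute)
     (simp add: outer_def transpose_def mult.commute)

lemma nonneg_matrix_mat_1: "nonneg_matrix (mat 1)"
  by (simp add: nonneg_matrix_def symmetric_matrix_def transpose_mat)

lemma nonneg_matrix_add: "nonneg_matrix P \<Longrightarrow> nonneg_matrix Q \<Longrightarrow> nonneg_matrix (P + Q)"
  by (auto simp: nonneg_matrix_def symmetric_matrix_def matrix_vector_mult_add_rdistrib inner_add_right
      transpose_def vec_eq_iff)

lemma nonneg_matrix_scaleR: "nonneg_matrix P \<Longrightarrow> 0 \<le> c \<Longrightarrow> nonneg_matrix (c *\<^sub>R P)"
  by (auto simp: nonneg_matrix_def symmetric_matrix_def transpose_def vec_eq_iff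
      scaleR_matrix_vector_assoc[symmetric])

text \<open>Ellipticity is used twice: from \<open>0\<close> to \<open>P\<close> with the constant
  \<open>a\<close>, and from \<open>P - Q\<close> to \<open>P\<close> with the constant
  \<open>A\<close>.\<close>

lemma structure_conditions_lower_bound:
  assumes F: "structure_conditions a A \<alpha> F" and "p \<noteq> 0" and P: "nonneg_matrix P" and Q: "nonneg_matrix Q"
  shows "norm p powr \<alpha> * (a * trace P - A * trace Q) \<le> F p (P - Q)"
proof -
  have sym0: "symmetric_matrix (0 :: real ^ 'n ^ 'n)"
    by (simp add: symmetric_matrix_def transpose_def vec_eq_iff)
  have symPQ: "symmetric_matrix (P - Q)"
    using P Q by (simp add: nonneg_matrix_def symmetric_matrix_def transpose_def vec_eq_iff)
  have hom: "\<And>t \<mu> p X. t \<noteq> 0 \<Longrightarrow> \<mu> > 0 \<Longrightarrow> p \<noteq> 0 \<Longrightarrow> symmetric_matrix X \<Longrightarrow>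
        F (t *\<^sub>R p) (\<mu> *\<^sub>R X) = \<bar>t\<bar> powr \<alpha> * \<mu> * F p X"
    and ell: "\<And>p M Z. p \<noteq> 0 \<Longrightarrow> symmetric_matrix M \<Longrightarrow> nonneg_matrix Z \<Longrightarrow>
        a * norm p powr \<alpha> * trace Z \<le> F p (M + Z) - F p M \<and>
        F p (M + Z) - F p M \<le> A * norm p powr \<alpha> * trace Z"
    using F unfolding structure_conditions_def by blast+
  \<comment> \<open>Homogeneity with factors \<open>1\<close> and \<open>2\<close> reads
    \<open>F p 0 = 2 * F p 0\<close>.\<close>
  have "F p 0 = 0" using hom[of 1 2 p 0] sym0 \<open>p \<noteq> 0\<close> by simp
  then have "a * norm p powr \<alpha> * trace P \<le> F p P"
    using ell[OF \<open>p \<noteq> 0\<close> sym0 P] by simp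
  moreover have "F p P - F p (P - Q) \<le> A * norm p powr \<alpha> * trace Q"
    using ell[OF \<open>p \<noteq> 0\<close> symPQ Q] by simp
  ultimately show ?thesis by (simp add: algebra_simps)
qed

section \<open>The bump and its derivatives\<close>

text \<open>For \<open>c = 1 / r ^ (2 * Suc n)\<close> this is the bump of the overview, centred at
  \<open>0\<close>. Powers of \<open>y \<bullet> y\<close> make it a polynomial, hence smooth at the
  centre too.\<close>

definition bump :: "real \<Rightarrow> nat \<Rightarrow> real ^ 'n \<Rightarrow> real" where
  "bump c n y = (1 - c * (y \<bullet> y) ^ Suc n)\<^sup>2"

definition bump_grad :: "real \<Rightarrow> nat \<Rightarrow> real ^ 'n \<Rightarrow> real ^ 'n" where
  "bump_grad c n y = (- 4 * c * real (Suc n) * (1 - c * (y \<bullet> y) ^ Suc n) * (y \<bullet> y) ^ n) *\<^sub>R y"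

text \<open>The Hessian is split into a difference of two matrices, both nonnegative inside the
  ball, because ellipticity weighs the two traces differently.\<close>

definition bump_hess_pos :: "real \<Rightarrow> nat \<Rightarrow> real ^ 'n \<Rightarrow> real ^ 'n ^ 'n" where
  "bump_hess_pos c n y = (8 * c\<^sup>2 * (real (Suc n))\<^sup>2 * (y \<bullet> y) ^ (2 * n)) *\<^sub>R outer y"

text \<open>For \<open>n = 0\<close> the truncated exponent \<open>n - 1\<close> is harmless: its term carries the factor \<open>n\<close>.\<close>

definition bump_hess_neg :: "real \<Rightarrow> nat \<Rightarrow> real ^ 'n \<Rightarrow> real ^ 'n ^ 'n" where
  "bump_hess_neg c n y = (4 * c * real (Suc n) * (1 - c * (y \<bullet> y) ^ Suc n)) *\<^sub>R
     ((2 * real n * (y \<bullet> y) ^ (n - 1)) *\<^sub>R outer y + (y \<bullet> y) ^ n *\<^sub>R mat 1)"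

lemma bump_has_derivative:
  "((\<lambda>x. \<kappa> * bump c n (x - h)) has_derivative (\<lambda>d. (\<kappa> *\<^sub>R bump_grad c n (x - h)) \<bullet> d)) (at x)"
  unfolding bump_def
  by (rule derivative_eq_intros refl ext | simp)+
     (simp add: bump_grad_def inner_commute algebra_simps)

lemma bump_grad_has_derivative:
  "((\<lambda>x. \<kappa> *\<^sub>R bump_grad c n (x - h)) has_derivative
     (\<lambda>d. (\<kappa> *\<^sub>R (bump_hess_pos c n (x - h) - bump_hess_neg c n (x - h))) *v d)) (at x)"
proof -
  define y where "y = x - h"
  \<comment> \<open>A multiple of \<open>y\<close> minus a multiple of \<open>d\<close> is the shape
    that the product rule produces for a scalar factor times \<open>x - h\<close>.\<close>
  have eq: "(\<kappa> *\<^sub>R (bump_hess_pos c n y - bump_hess_neg c n y)) *v d =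
     (8 * \<kappa> * c\<^sup>2 * (real (Suc n))\<^sup>2 * (y \<bullet> y) ^ (2 * n) * (y \<bullet> d)
       - 4 * \<kappa> * c * real (Suc n) * (1 - c * (y \<bullet> y) ^ Suc n) * (2 * real n * (y \<bullet> y) ^ (n - 1)) * (y \<bullet> d)) *\<^sub>R y
     - (4 * \<kappa> * c * real (Suc n) * (1 - c * (y \<bullet> y) ^ Suc n) * (y \<bullet> y) ^ n) *\<^sub>R d" for d
    unfolding bump_hess_pos_def bump_hess_neg_def
    by (simp add: scaleR_matrix_vector_assoc[symmetric] matrix_vector_mult_diff_rdistrib
        matrix_vector_mult_add_rdistrib outer_vector_mult scaleR_diff_right scaleR_add_right
        scaleR_diff_left mult_ac del: of_nat_Suc)
  have dn: "((\<lambda>x. ((x - h) \<bullet> (x - h)) ^ k) has_derivative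
      (\<lambda>d. 2 * real k * (y \<bullet> y) ^ (k - 1) * (y \<bullet> d))) (at x)" for k
    unfolding y_def by (auto intro!: derivative_eq_intros simp: inner_commute)
  have dw: "((\<lambda>x. - 4 * \<kappa> * c * real (Suc n) * ((1 - c * ((x - h) \<bullet> (x - h)) ^ Suc n) * ((x - h) \<bullet> (x - h)) ^ n))
      has_derivative (\<lambda>d. - 4 * \<kappa> * c * real (Suc n) *
        ((1 - c * (y \<bullet> y) ^ Suc n) * (2 * real n * (y \<bullet> y) ^ (n - 1) * (y \<bullet> d))
         + (0 - c * (2 * real (Suc n) * (y \<bullet> y) ^ (Suc n - 1) * (y \<bullet> d))) * (y \<bullet> y) ^ n))) (at x)"
    unfolding y_def
    by (intro has_derivative_mult_right has_derivative_mult has_derivative_diff has_derivative_const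
        dn[unfolded y_def])
  have dy: "((\<lambda>x. x - h) has_derivative (\<lambda>d. d)) (at x)"
    by (auto intro!: derivative_eq_intros)
  show ?thesis
    unfolding eq[unfolded y_def] unfolding bump_grad_def
    by (rule has_derivative_eq_rhs[OF has_derivative_transform[OF UNIV_I _ has_derivative_scaleR[OF dw dy]]];
        simp del: of_nat_Suc power_Suc
          add: y_def[symmetric] fun_eq_iff scaleR_diff_left scaleR_add_left power_mult power2_eq_square
            power_mult_distrib)
       (simp add: algebra_simps del: of_nat_Suc power_Suc)
qed

lemma continuous_on_bump_hess:
  "continuous_on S (\<lambda>x. \<kappa> *\<^sub>R (bump_hess_pos c n (x - h) - bump_hess_neg c n (x - h)))"
  unfolding bump_hess_pos_def bump_hess_neg_def outer_def
  by (intro continuous_intros)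

lemma grad_bump: "grad (\<lambda>x. \<kappa> * bump c n (x - h)) = (\<lambda>x. \<kappa> *\<^sub>R bump_grad c n (x - h))"
  by (rule ext) (rule grad_eqI[OF bump_has_derivative])

lemma hess_bump: "hess (\<lambda>x. \<kappa> * bump c n (x - h)) =
    (\<lambda>x. \<kappa> *\<^sub>R (bump_hess_pos c n (x - h) - bump_hess_neg c n (x - h)))"
  by (rule ext, rule hess_eqI) (simp add: grad_bump bump_grad_has_derivative)

lemma C2_on_bump: "C2_on \<Omega> (\<lambda>x. \<kappa> * bump c n (x - h))"
  unfolding C2_on_def grad_bump hess_bump differentiable_def
  using bump_has_derivative bump_grad_has_derivative continuous_on_bump_hess by blast

lemma nonneg_matrix_bump_hess_pos: "nonneg_matrix (bump_hess_pos c n y)"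
  unfolding bump_hess_pos_def by (intro nonneg_matrix_scaleR nonneg_matrix_outer) simp

lemma nonneg_matrix_bump_hess_neg:
  assumes "0 \<le> c" "c * (y \<bullet> y) ^ Suc n \<le> 1"
  shows "nonneg_matrix (bump_hess_neg c n y)"
  unfolding bump_hess_neg_def using assms
  by (intro nonneg_matrix_scaleR nonneg_matrix_add nonneg_matrix_outer nonneg_matrix_mat_1) auto

lemma trace_bump_hess_pos:
  "trace (bump_hess_pos c n y) = 8 * c\<^sup>2 * (real (Suc n))\<^sup>2 * (y \<bullet> y) ^ Suc (2 * n)"
  by (simp add: bump_hess_pos_def trace_scaleR trace_outer)

lemma trace_bump_hess_neg:
  assumes "n \<ge> 1"
  shows "trace (bump_hess_neg c n (y :: real ^ 'n)) =
    4 * c * real (Suc n) * (1 - c * (y \<bullet> y) ^ Suc n) * (2 * real n + CARD('n)) * (y \<bullet> y) ^ n"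
proof -
  have "(y \<bullet> y) ^ (n - 1) * (y \<bullet> y) = (y \<bullet> y) ^ n"
    using assms by (metis Suc_diff_1 less_eq_Suc_le One_nat_def power_Suc2)
  then have "trace ((2 * real n * (y \<bullet> y) ^ (n - 1)) *\<^sub>R outer y + (y \<bullet> y) ^ n *\<^sub>R mat 1) =
      (2 * real n + CARD('n)) * (y \<bullet> y) ^ n"
    by (simp add: trace_scaleR trace_add trace_outer trace_I ring_distribs mult.assoc)
  then show ?thesis
    by (simp add: bump_hess_neg_def trace_scaleR mult.assoc)
qed

section \<open>The contact point and the estimate there\<close>

text \<open>A nonnegative continuous function over a positive lower semicontinuous one is upper
  semicontinuous. The maximiser will be the contact point.\<close>

lemma quotient_attains_sup:
  fixes b v :: "'a::metric_space \<Rightarrow> real"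
  assumes K: "compact K" "K \<noteq> {}" and b: "continuous_on K b" "\<And>x. x \<in> K \<Longrightarrow> 0 \<le> b x"
    and v: "\<And>x. x \<in> K \<Longrightarrow> 0 < v x"
    and lsc: "\<And>x t. x \<in> K \<Longrightarrow> t < v x \<Longrightarrow> \<exists>d>0. \<forall>y\<in>K. dist x y < d \<longrightarrow> t < v y"
  shows "\<exists>x\<in>K. \<forall>y\<in>K. b y / v y \<le> b x / v x"
proof (rule usc_attains_sup[OF K])
  fix x t assume x: "x \<in> K" and t: "b x / v x < t"
  have "0 \<le> b x / v x" using b(2)[OF x] v[OF x] by simp
  with t have "t > 0" by linarith
  then have "b x / t < v x" using t v[OF x] by (simp add: field_simps)
  \<comment> \<open>The level \<open>s\<close> separates the two functions: near \<open>x\<close>,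
    \<open>v\<close> stays above \<open>s\<close> and \<open>b\<close> below
    \<open>t * s\<close>.\<close>
  then obtain s where s: "b x / t < s" "s < v x" using dense by blast
  obtain d1 where d1: "d1 > 0" "\<And>y. y \<in> K \<Longrightarrow> dist x y < d1 \<Longrightarrow> s < v y"
    using lsc[OF x s(2)] by blast
  have "b x < t * s" using s \<open>t > 0\<close> by (simp add: field_simps)
  then obtain d2 where d2: "d2 > 0" "\<And>y. y \<in> K \<Longrightarrow> dist y x < d2 \<Longrightarrow> dist (b y) (b x) < t * s - b x"
    using b(1) x unfolding continuous_on_iff by (metis diff_gt_0_iff_gt)
  show "\<exists>d>0. \<forall>y\<in>K. dist x y < d \<longrightarrow> b y / v y < t"
  proof (intro exI[of _ "min d1 d2"] conjI ballI impI)
    fix y assume y: "y \<in> K" "dist x y < min d1 d2"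
    have "b y < t * s" using d2(2)[of y] y by (simp add: dist_commute dist_real_def)
    also have "\<dots> < t * v y" using d1(2)[of y] y \<open>t > 0\<close> by simp
    finally show "b y / v y < t" using v[OF y(1)] by (simp add: field_simps)
  qed (use d1 d2 in auto)
qed

lemma bump_bounds:
  assumes "0 < r" "norm y \<le> r"
  shows "1 / r ^ (2 * Suc n) * (y \<bullet> y) ^ Suc n = (norm y / r) ^ (2 * Suc n)"
    and "(norm y / r) ^ (2 * Suc n) \<le> 1"
proof -
  have "(norm y / r) ^ (2 * Suc n) = (y \<bullet> y) ^ Suc n / r ^ (2 * Suc n)"
    by (simp only: power_divide power_mult dot_square_norm)
  then show "1 / r ^ (2 * Suc n) * (y \<bullet> y) ^ Suc n = (norm y / r) ^ (2 * Suc n)" by simp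
  show "(norm y / r) ^ (2 * Suc n) \<le> 1" using assms by (intro power_le_one) auto
qed

lemma bump_eq:
  assumes "0 < r" "norm y \<le> r"
  shows "bump (1 / r ^ (2 * Suc n)) n y = (1 - (norm y / r) ^ (2 * Suc n))\<^sup>2"
  unfolding bump_def bump_bounds[OF assms] ..

text \<open>The quotient \<open>2 * a * m / (B + 2 * a * m)\<close> is the lower bound for
  \<open>u\<close> at a contact point; \<open>N\<close> is the dimension.\<close>

definition bound_const :: "real \<Rightarrow> real \<Rightarrow> real \<Rightarrow> nat \<Rightarrow> nat \<Rightarrow> real" where
  "bound_const a A \<alpha> N n =
     (let B = A * (2 * real n + real N); m = real (Suc n)
      in B * (4 * m) powr (\<alpha> + 1) / (2 * a * m / (B + 2 * a * m)) powr (\<alpha> + 1))"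

text \<open>
  Here \<open>\<rho>\<close> is the rescaled distance to the centre of the bump, \<open>u\<^sup>2\<close> is the value and \<open>p\<close> the length of
  the gradient of the bump. Near the boundary (small \<open>u\<close>) the right-hand side of the inequality is
  negative, hence \<open>u\<close> is bounded away from \<open>0\<close>; near the centre, the factor \<open>p powr \<alpha>\<close>, singular for
  \<open>\<alpha> < 0\<close>, is compensated by \<open>\<rho> ^ (2 * n)\<close> because of the lower bound on \<open>n\<close>.
\<close>

lemma bump_scalar_estimate:
  fixes a B \<alpha> r \<rho> m :: real and n :: nat
  assumes pos: "0 < a" "0 < B" "0 < r" "0 < \<rho>" "\<rho> < 1" "0 < m" and \<alpha>: "\<alpha> > -1"
    and n: "1 \<le> (2 * real n + 1) * (\<alpha> + 1)"
    and u: "u = 1 - \<rho> ^ (2 * Suc n)"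
    and p: "p = 4 * m * u * \<rho> ^ (2 * n + 1) / r"
    and ineq: "\<mu> * (u\<^sup>2) powr (\<alpha> + 1) \<le> p powr \<alpha> * (4 * m * \<rho> ^ (2 * n) / r\<^sup>2 * (B * u - 2 * a * m * (1 - u)))"
  shows "\<mu> \<le> B * (4 * m) powr (\<alpha> + 1) / (2 * a * m / (B + 2 * a * m)) powr (\<alpha> + 1) / r powr (\<alpha> + 2)"
proof (cases "\<mu> > 0")
  case False
  moreover have "0 \<le> B * (4 * m) powr (\<alpha> + 1) / (2 * a * m / (B + 2 * a * m)) powr (\<alpha> + 1) / r powr (\<alpha> + 2)"
    using pos by simp
  ultimately show ?thesis by linarith
next
  case True
  have u01: "0 < u" "u < 1"
    unfolding u using pos by (simp_all add: power_less_one_iff del: power_Suc mult_Suc_right)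
  have p0: "p > 0" using pos u01 by (simp add: p)
  \<comment> \<open>A positive left-hand side forces the last factor on the right to be positive,
    which bounds \<open>u\<close> from below.\<close>
  have "0 < \<mu> * (u\<^sup>2) powr (\<alpha> + 1)" using True u01 by simp
  then have "0 < p powr \<alpha> * (4 * m * \<rho> ^ (2 * n) / r\<^sup>2) * (B * u - 2 * a * m * (1 - u))"
    using ineq by (simp add: mult.assoc)
  moreover have "0 < p powr \<alpha> * (4 * m * \<rho> ^ (2 * n) / r\<^sup>2)" using p0 pos by simp
  ultimately have "0 < B * u - 2 * a * m * (1 - u)" using zero_less_mult_pos by blast
  then have u0: "2 * a * m / (B + 2 * a * m) \<le> u"
    using pos by (simp add: divide_le_eq add_pos_pos algebra_simps)
  \<comment> \<open>The lower bound on \<open>n\<close> enters here; the resulting factor \<rho>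
    cancels the \<open>1 / \<rho>\<close> that appears below.\<close>
  have "\<rho> powr ((2 * real n + 1) * (\<alpha> + 1)) \<le> \<rho> powr 1"
    by (rule powr_mono') (use n pos in auto)
  moreover have "\<rho> powr ((2 * real n + 1) * (\<alpha> + 1)) = (\<rho> ^ (2 * n + 1)) powr (\<alpha> + 1)"
    using pos powr_realpow[of \<rho> "2 * n + 1"] by (simp add: powr_powr[symmetric] add.commute)
  ultimately have \<rho>_le: "(\<rho> ^ (2 * n + 1)) powr (\<alpha> + 1) \<le> \<rho>" using pos by simp
  \<comment> \<open>One of the two copies of \<open>u powr (\<alpha> + 1)\<close> cancels against
    the one in \<open>p powr (\<alpha> + 1)\<close>; the other is bounded below.\<close>
  have "\<mu> * u powr (\<alpha> + 1) * u powr (\<alpha> + 1) = \<mu> * (u\<^sup>2) powr (\<alpha> + 1)"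
    using u01 by (simp add: power2_eq_square powr_mult)
  also have "\<dots> \<le> p powr \<alpha> * (4 * m * \<rho> ^ (2 * n) / r\<^sup>2 * (B * u - 2 * a * m * (1 - u)))"
    by (rule ineq)
  also have "\<dots> \<le> p powr \<alpha> * (4 * m * \<rho> ^ (2 * n) / r\<^sup>2 * (B * u))"
    using pos u01 by (intro mult_left_mono) auto
  also have "\<dots> = p powr \<alpha> * p * B / (\<rho> * r)"
    using pos by (simp add: p power2_eq_square field_simps)
  also have "p powr \<alpha> * p = p powr (\<alpha> + 1)" using p0 by (simp add: powr_add)
  also have "p powr (\<alpha> + 1) = (4 * m) powr (\<alpha> + 1) * u powr (\<alpha> + 1) * (\<rho> ^ (2 * n + 1)) powr (\<alpha> + 1) / r powr (\<alpha> + 1)"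
    unfolding p using pos u01 by (simp add: powr_divide powr_mult del: power_Suc power_add)
  also have "\<dots> * B / (\<rho> * r) \<le> (4 * m) powr (\<alpha> + 1) * u powr (\<alpha> + 1) * \<rho> / r powr (\<alpha> + 1) * B / (\<rho> * r)"
    using pos u01 \<rho>_le by (intro divide_right_mono mult_right_mono mult_left_mono) auto
  also have "\<dots> = B * (4 * m) powr (\<alpha> + 1) / r powr (\<alpha> + 2) * u powr (\<alpha> + 1)"
    using pos powr_add[of r "\<alpha> + 1" 1] by (simp add: field_simps)
  finally have "\<mu> * u powr (\<alpha> + 1) \<le> B * (4 * m) powr (\<alpha> + 1) / r powr (\<alpha> + 2)"
    by (rule mult_right_le_imp_le) (use u01 in simp)
  moreover have "(2 * a * m / (B + 2 * a * m)) powr (\<alpha> + 1) \<le> u powr (\<alpha> + 1)"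
    using pos \<alpha> u0 by (intro powr_mono2) auto
  then have "\<mu> * (2 * a * m / (B + 2 * a * m)) powr (\<alpha> + 1) \<le> \<mu> * u powr (\<alpha> + 1)"
    using True by simp
  ultimately have *: "\<mu> * (2 * a * m / (B + 2 * a * m)) powr (\<alpha> + 1) \<le> B * (4 * m) powr (\<alpha> + 1) / r powr (\<alpha> + 2)"
    by linarith
  have "B + 2 * a * m > 0" using pos by (simp add: add_pos_pos)
  then have "0 < (2 * a * m / (B + 2 * a * m)) powr (\<alpha> + 1)" using pos by simp
  with * have "\<mu> \<le> B * (4 * m) powr (\<alpha> + 1) / r powr (\<alpha> + 2) / (2 * a * m / (B + 2 * a * m)) powr (\<alpha> + 1)"
    by (simp only: pos_le_divide_eq)
  then show ?thesis by (simp only: divide_divide_eq_left mult.commute)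
qed

text \<open>Ellipticity and the two traces turn the matrix inequality into the scalar one, with
  \<open>\<rho> = norm y / r\<close>.\<close>

lemma bump_estimate:
  fixes F :: "real ^ 'n \<Rightarrow> real ^ 'n ^ 'n \<Rightarrow> real"
  assumes F: "structure_conditions a A \<alpha> F" and "0 < a" "0 < A" and \<alpha>: "\<alpha> > -1"
    and n: "n \<ge> 1" "1 \<le> (2 * real n + 1) * (\<alpha> + 1)"
    and r: "0 < r" and y: "y \<noteq> 0" "norm y < r" and c: "c = 1 / r ^ (2 * Suc n)"
    and le: "F (bump_grad c n y) (bump_hess_pos c n y - bump_hess_neg c n y) \<le> - \<mu> * bump c n y powr (\<alpha> + 1)"
  shows "\<mu> \<le> bound_const a A \<alpha> CARD('n) n / r powr (\<alpha> + 2)"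
proof -
  define \<rho> where "\<rho> = norm y / r"
  define u where "u = 1 - \<rho> ^ (2 * Suc n)"
  define m where "m = real (Suc n)"
  define B where "B = A * (2 * real n + CARD('n))"
  have \<rho>: "0 < \<rho>" "\<rho> < 1" using r y by (simp_all add: \<rho>_def)
  have m: "m > 0" by (simp add: m_def)
  have cs: "c * (y \<bullet> y) ^ Suc n = 1 - u" and cle: "c * (y \<bullet> y) ^ Suc n \<le> 1"
    using bump_bounds[of r y n] r y by (simp_all add: c u_def \<rho>_def del: power_Suc mult_Suc_right)
  have u0: "u > 0"
    unfolding u_def using \<rho> by (simp add: power_less_one_iff del: power_Suc mult_Suc_right)
  have c0: "c > 0" using r by (simp add: c)
  have ny: "norm y = \<rho> * r" and yy: "y \<bullet> y = (\<rho> * r)\<^sup>2"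
    using r by (simp_all add: \<rho>_def dot_square_norm)
  \<comment> \<open>The two spare powers of \<open>r\<close> in \<open>c\<close> give the scaling
    \<open>1 / r\<^sup>2\<close> of second derivatives.\<close>
  have c_pow: "c * (y \<bullet> y) ^ n = \<rho> ^ (2 * n) / r\<^sup>2"
    using r by (simp add: c yy power_mult_distrib power_mult del: mult_Suc_right)
  have p: "norm (bump_grad c n y) = 4 * m * u * \<rho> ^ (2 * n + 1) / r"
  proof -
    have "norm (bump_grad c n y) = 4 * m * u * (c * (y \<bullet> y) ^ n) * norm y"
      unfolding bump_grad_def cs using c0 u0 m by (simp add: abs_mult m_def[symmetric] mult_ac del: of_nat_Suc)
    then show ?thesis unfolding c_pow ny using r by (simp add: power2_eq_square)
  qed
  also have "\<dots> > 0" using m u0 \<rho> r by simp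
  finally have pn0: "bump_grad c n y \<noteq> 0" by simp
  have trP: "trace (bump_hess_pos c n y) = 4 * m * \<rho> ^ (2 * n) / r\<^sup>2 * (2 * m * (1 - u))"
  proof -
    have "trace (bump_hess_pos c n y) = 8 * m\<^sup>2 * (c * (y \<bullet> y) ^ n) * (c * (y \<bullet> y) ^ Suc n)"
      unfolding trace_bump_hess_pos m_def power_Suc power_even_eq
      by (simp add: power2_eq_square mult_ac del: of_nat_Suc)
    then show ?thesis unfolding cs c_pow by (simp add: power2_eq_square)
  qed
  have trQ: "A * trace (bump_hess_neg c n y) = 4 * m * \<rho> ^ (2 * n) / r\<^sup>2 * (B * u)"
  proof -
    have "A * trace (bump_hess_neg c n y) = 4 * m * u * B * (c * (y \<bullet> y) ^ n)"
      unfolding trace_bump_hess_neg[OF n(1)] cs B_def m_def by simp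
    then show ?thesis unfolding c_pow by simp
  qed
  have "\<mu> * (u\<^sup>2) powr (\<alpha> + 1) \<le> - F (bump_grad c n y) (bump_hess_pos c n y - bump_hess_neg c n y)"
    using le by (simp add: bump_def cs del: power_Suc)
  also have "\<dots> \<le> - (norm (bump_grad c n y) powr \<alpha> *
      (a * trace (bump_hess_pos c n y) - A * trace (bump_hess_neg c n y)))"
    using structure_conditions_lower_bound[OF F pn0 nonneg_matrix_bump_hess_pos
        nonneg_matrix_bump_hess_neg[OF _ cle]] c0 by simp
  also have "\<dots> = norm (bump_grad c n y) powr \<alpha> *
      (4 * m * \<rho> ^ (2 * n) / r\<^sup>2 * (B * u - 2 * a * m * (1 - u)))"
    unfolding trP trQ by (simp add: algebra_simps diff_divide_distrib add_divide_distrib)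
  finally have ineq: "\<mu> * (u\<^sup>2) powr (\<alpha> + 1) \<le> norm (bump_grad c n y) powr \<alpha> *
      (4 * m * \<rho> ^ (2 * n) / r\<^sup>2 * (B * u - 2 * a * m * (1 - u)))" .
  have "B > 0" unfolding B_def using \<open>0 < A\<close> by (simp add: add_nonneg_pos)
  from bump_scalar_estimate[OF \<open>0 < a\<close> this r \<rho> m \<alpha> n(2) u_def p ineq]
  show ?thesis by (simp add: bound_const_def B_def m_def Let_def)
qed

section \<open>The bound obtained from one ball\<close>

text \<open>The gap between \<open>r\<close> and \<open>R\<close> leaves room to move the centre
  \<open>h\<close> of the bump, which is how contact at the centre is avoided.\<close>

lemma admissible_le:
  fixes F :: "real ^ 'n \<Rightarrow> real ^ 'n ^ 'n \<Rightarrow> real"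
  assumes F: "structure_conditions a A \<alpha> F" and aA: "0 < a" "0 < A" and \<alpha>: "\<alpha> > -1"
    and n: "n \<ge> 1" "1 \<le> (2 * real n + 1) * (\<alpha> + 1)"
    and \<mu>: "\<mu> \<in> admissible_lambdas F \<alpha> \<Omega>" and ball: "ball x\<^sub>0 R \<subseteq> \<Omega>" and r: "0 < r" "r < R"
  shows "\<mu> \<le> bound_const a A \<alpha> CARD('n) n / r powr (\<alpha> + 2)"
proof (cases "\<mu> > 0")
  case False
  moreover have "0 \<le> bound_const a A \<alpha> CARD('n) n / r powr (\<alpha> + 2)"
    using aA by (auto simp: bound_const_def Let_def)
  ultimately show ?thesis by linarith
next
  case True
  obtain \<phi> where v0: "\<And>x. x \<in> \<Omega> \<Longrightarrow> lsc_env \<Omega> \<phi> x > 0"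
    and visc: "viscosity_supersolution F (\<lambda>x s. - \<mu> * \<bar>s\<bar> powr \<alpha> * s) \<Omega> \<phi>"
    using \<mu> unfolding admissible_lambdas_def by blast
  define v where "v = lsc_env \<Omega> \<phi>"
  have bdd: "bounded (\<phi> ` closure \<Omega>)" using visc by (simp add: viscosity_supersolution_def)
  interpret bounded_on_closure \<Omega> \<phi> by unfold_locales (rule bdd)
  have cl: "x \<in> closure \<Omega>" if "x \<in> \<Omega>" for x using that closure_subset by blast
  have not_const: "\<not> (\<exists>\<delta> c. \<delta> > 0 \<and> ball z \<delta> \<subseteq> \<Omega> \<and> (\<forall>y\<in>ball z \<delta>. v y = c))" if z: "z \<in> \<Omega>" for z
  proof
    assume "\<exists>\<delta> c. \<delta> > 0 \<and> ball z \<delta> \<subseteq> \<Omega> \<and> (\<forall>y\<in>ball z \<delta>. v y = c)"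
    then obtain \<delta> c where d: "\<delta> > 0" "ball z \<delta> \<subseteq> \<Omega>" "\<forall>y\<in>ball z \<delta>. v y = c" by blast
    then have "0 \<le> - \<mu> * \<bar>c\<bar> powr \<alpha> * c"
      using visc[unfolded viscosity_supersolution_def v_def[symmetric], THEN conjunct2, rule_format,
          OF z, THEN conjunct1, rule_format, of \<delta> c z] by simp
    moreover have "c > 0" using d z v0[OF z] by (auto simp: v_def)
    then have "0 < \<mu> * \<bar>c\<bar> powr \<alpha> * c" using True by simp
    ultimately show False by simp
  qed
  obtain M where M: "\<And>x. x \<in> \<Omega> \<Longrightarrow> v x \<le> M"
  proof -
    obtain M where "\<And>x. x \<in> closure \<Omega> \<Longrightarrow> norm (\<phi> x) \<le> M" using bdd unfolding bounded_iff by blast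
    then have "\<phi> x \<le> M" if "x \<in> \<Omega>" for x using cl[OF that] by (auto simp: abs_le_iff)
    then show thesis using lsc_env_le cl that[of M] unfolding v_def by (blast intro: order_trans)
  qed
  define c where "c = 1 / r ^ (2 * Suc n)"
  have c0: "c > 0" using r by (simp add: c_def)
  \<comment> \<open>\<open>R - r\<close> keeps each \<open>cball h r\<close> inside \<Omega>;
    \<open>r / 2\<close> puts any two points of the small ball within distance \<open>r\<close>, so
    bumps centred at either can be compared at the other.\<close>
  define e where "e = min (R - r) (r / 2)"
  have e: "e > 0" "e \<le> R - r" "e \<le> r / 2" using r unfolding e_def by linarith+
  have cball_sub: "cball h r \<subseteq> \<Omega>" if "h \<in> ball x\<^sub>0 e" for h
  proof
    fix z assume "z \<in> cball h r"
    then have "dist x\<^sub>0 z < R" using that e dist_triangle[of x\<^sub>0 z h] by auto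
    then show "z \<in> \<Omega>" using ball by auto
  qed
  have x0: "x\<^sub>0 \<in> \<Omega>" using ball r by auto
  have bump0: "bump c n (0 :: real ^ 'n) = 1" by (simp add: bump_def)
  \<comment> \<open>If touching always happened at the centre of the bump, where the gradient vanishes, then
    \<open>v\<close> would have a quadratic modulus of continuity and be constant near \<open>x\<^sub>0\<close>.\<close>
  have "\<exists>h\<in>ball x\<^sub>0 e. \<exists>y\<in>cball h r. v y < v h * bump c n (y - h)"
  proof (rule ccontr)
    assume "\<not> ?thesis"
    then have ge: "v h * bump c n (y - h) \<le> v y" if "h \<in> ball x\<^sub>0 e" "y \<in> cball h r" for h y
      using that by force
    \<comment> \<open>The constant arises because the bump is at least
      \<open>1 - 2 * \<rho>\<^sup>2\<close> at relative distance \<rho>, while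
      \<open>v x \<le> M\<close>.\<close>
    have "v x - v y \<le> (M * 2 / r\<^sup>2) * (norm (x - y))\<^sup>2" if x: "x \<in> ball x\<^sub>0 e" and y: "y \<in> ball x\<^sub>0 e" for x y
    proof -
      define \<rho> where "\<rho> = norm (y - x) / r"
      have "dist x y \<le> r" using x y e dist_triangle3[of x y x\<^sub>0] by auto
      then have nr: "norm (y - x) \<le> r" by (simp add: dist_norm norm_minus_commute)
      have xO: "x \<in> \<Omega>" using cball_sub[OF x] r by auto
      have \<rho>: "0 \<le> \<rho>" "\<rho> \<le> 1" using nr r by (auto simp: \<rho>_def)
      have "v x * bump c n (y - x) \<le> v y" using ge[OF x] \<open>dist x y \<le> r\<close> by simp
      moreover have "bump c n (y - x) \<ge> 1 - 2 * \<rho>\<^sup>2"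
      proof -
        have "\<rho> ^ (2 * Suc n) \<le> \<rho>\<^sup>2" using \<rho> by (intro power_decreasing) auto
        moreover have "bump c n (y - x) = (1 - \<rho> ^ (2 * Suc n))\<^sup>2"
          unfolding c_def \<rho>_def using bump_eq r nr by blast
        moreover have "(1 - \<rho> ^ (2 * Suc n))\<^sup>2 \<ge> 1 - 2 * \<rho> ^ (2 * Suc n)"
          using zero_le_power2[of "\<rho> ^ (2 * Suc n)"] by (simp add: power2_diff del: power_Suc mult_Suc_right)
        ultimately show ?thesis by linarith
      qed
      then have "v x * (1 - 2 * \<rho>\<^sup>2) \<le> v x * bump c n (y - x)"
        using v0[OF xO] by (intro mult_left_mono) (auto simp: v_def)
      ultimately have "v x * (1 - 2 * \<rho>\<^sup>2) \<le> v y" by linarith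
      then have "v x - v y \<le> v x * (2 * \<rho>\<^sup>2)" by (simp add: algebra_simps)
      also have "\<dots> \<le> M * (2 * \<rho>\<^sup>2)" using M[OF xO] by (intro mult_right_mono) auto
      finally show ?thesis by (simp add: \<rho>_def power_divide norm_minus_commute)
    qed
    then have "\<exists>k. \<forall>y\<in>ball x\<^sub>0 e. v y = k" by (rule constant_on_ball_if_square_modulus)
    moreover have "ball x\<^sub>0 e \<subseteq> \<Omega>" using cball_sub r by (meson centre_in_cball less_imp_le subset_iff)
    ultimately show False using not_const[OF x0] e(1) by blast
  qed
  then obtain h y\<^sub>0 where h: "h \<in> ball x\<^sub>0 e" and y0: "y\<^sub>0 \<in> cball h r" "v y\<^sub>0 < v h * bump c n (y\<^sub>0 - h)" by blast
  note K = cball_sub[OF h]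
  have hK: "h \<in> cball h r" using r by simp
  have vpos: "v x > 0" if "x \<in> cball h r" for x using that K v0 by (auto simp: v_def)
  have "\<exists>x\<in>cball h r. \<forall>y\<in>cball h r. bump c n (y - h) / v y \<le> bump c n (x - h) / v x"
  proof (rule quotient_attains_sup)
    show "continuous_on (cball h r) (\<lambda>x. bump c n (x - h))"
      unfolding bump_def by (intro continuous_intros)
    fix x t assume "x \<in> cball h r" "t < v x"
    then obtain d where "d > 0" "\<And>y. y \<in> closure \<Omega> \<Longrightarrow> dist x y < d \<Longrightarrow> t < v y"
      using lsc_env_lsc[of x t] K cl unfolding v_def by blast
    then show "\<exists>d>0. \<forall>y\<in>cball h r. dist x y < d \<longrightarrow> t < v y" using K cl by blast
  qed (use r vpos in \<open>auto simp: bump_def\<close>)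
  then obtain x where x: "x \<in> cball h r"
    and max: "\<And>y. y \<in> cball h r \<Longrightarrow> bump c n (y - h) / v y \<le> bump c n (x - h) / v x" by blast
  have bx: "bump c n (x - h) > 0"
  proof -
    have "0 < bump c n (h - h) / v h" using vpos[OF hK] by (simp add: bump0)
    also have "\<dots> \<le> bump c n (x - h) / v x" by (rule max[OF hK])
    finally show ?thesis using vpos[OF x] by (simp add: zero_less_divide_iff)
  qed
  \<comment> \<open>At \<open>h\<close> the quotient is \<open>1 / v h\<close>, and
    \<open>y\<^sub>0\<close> was chosen to exceed it.\<close>
  have "x \<noteq> h"
  proof
    assume "x = h"
    then have "bump c n (y\<^sub>0 - h) / v y\<^sub>0 \<le> 1 / v h" using max[OF y0(1)] by (simp add: bump0)
    then show False using y0(2) vpos[OF y0(1)] vpos[OF hK] by (simp add: field_simps)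
  qed
  then have y: "x - h \<noteq> 0" by simp
  have nr: "norm (x - h) < r"
  proof (rule ccontr)
    assume "\<not> ?thesis"
    then have "norm (x - h) = r" using x by (simp add: dist_norm norm_minus_commute)
    then have "bump c n (x - h) = 0" using bump_eq[of r "x - h" n] r by (simp add: c_def)
    with bx show False by simp
  qed
  \<comment> \<open>The factor for which the scaled bump touches \<open>v\<close> at
    \<open>x\<close>; maximality of the quotient keeps it below \<open>v\<close> elsewhere.\<close>
  define \<kappa> where "\<kappa> = v x / bump c n (x - h)"
  have \<kappa>: "\<kappa> > 0" using vpos[OF x] bx by (simp add: \<kappa>_def)
  have vx: "v x = \<kappa> * bump c n (x - h)" using bx by (simp add: \<kappa>_def)
  have xO: "x \<in> \<Omega>" using x K by blast
  have "\<forall>\<^sub>F y in nhds x. y \<in> ball h r"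
    by (rule eventually_nhds_in_open) (use nr in \<open>auto simp: dist_norm norm_minus_commute\<close>)
  then have loc_min: "\<forall>\<^sub>F y in nhds x. v x - \<kappa> * bump c n (x - h) \<le> v y - \<kappa> * bump c n (y - h)"
  proof eventually_elim
    case (elim y)
    then have yK: "y \<in> cball h r" by simp
    have "\<kappa> * bump c n (y - h) \<le> v y"
      using max[OF yK] vpos[OF yK] vpos[OF x] bx by (simp add: \<kappa>_def field_simps)
    then show ?case using vx by simp
  qed
  \<comment> \<open>The gradient has the zeros of the bump and the centre as its only zeros, both
    already excluded.\<close>
  have grad_ne: "bump_grad c n (x - h) \<noteq> 0"
    using bx y c0 by (auto simp: bump_grad_def bump_def)
  have "F (\<kappa> *\<^sub>R bump_grad c n (x - h)) (\<kappa> *\<^sub>R (bump_hess_pos c n (x - h) - bump_hess_neg c n (x - h)))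
      \<le> - \<mu> * \<bar>v x\<bar> powr \<alpha> * v x"
  proof -
    have test: "F (grad \<psi> x) (hess \<psi> x) \<le> - \<mu> * \<bar>v x\<bar> powr \<alpha> * v x"
      if "C2_on \<Omega> \<psi>" "\<forall>\<^sub>F y in nhds x. v x - \<psi> x \<le> v y - \<psi> y" "grad \<psi> x \<noteq> 0" for \<psi>
      using visc[unfolded viscosity_supersolution_def v_def[symmetric], THEN conjunct2, rule_format,
          OF xO, THEN conjunct2, rule_format, OF not_const[OF xO] that] .
    show ?thesis
      using test[OF C2_on_bump loc_min] grad_ne \<kappa> by (simp add: grad_bump hess_bump)
  qed
  moreover have "symmetric_matrix (bump_hess_pos c n (x - h) - bump_hess_neg c n (x - h))"
  proof -
    have "c * ((x - h) \<bullet> (x - h)) ^ Suc n \<le> 1"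
      unfolding c_def using bump_bounds[of r "x - h" n] r nr by simp
    then show ?thesis
      using nonneg_matrix_bump_hess_pos[of c n "x - h"] nonneg_matrix_bump_hess_neg[of c "x - h" n] c0
      by (simp add: nonneg_matrix_def symmetric_matrix_def transpose_def vec_eq_iff)
  qed
  \<comment> \<open>Both homogeneity factors are \<kappa>, so
    \<open>\<kappa> powr \<alpha> * \<kappa>\<close> comes out on the left; it comes out on the
    right because \<open>v x\<close> is \<kappa> times the bump.\<close>
  ultimately have "\<kappa> powr \<alpha> * \<kappa> * F (bump_grad c n (x - h)) (bump_hess_pos c n (x - h) - bump_hess_neg c n (x - h))
      \<le> - \<mu> * (v x powr \<alpha> * v x)"
    using F[unfolded structure_conditions_def, THEN conjunct1, rule_format, of \<kappa> \<kappa>] \<kappa> grad_ne vpos[OF x]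
    by (simp add: mult.assoc)
  also have "v x powr \<alpha> * v x = \<kappa> powr \<alpha> * \<kappa> * bump c n (x - h) powr (\<alpha> + 1)"
    using \<kappa> bx by (simp add: vx powr_mult powr_add)
  finally have "(\<kappa> powr \<alpha> * \<kappa>) * F (bump_grad c n (x - h)) (bump_hess_pos c n (x - h) - bump_hess_neg c n (x - h))
      \<le> (\<kappa> powr \<alpha> * \<kappa>) * (- \<mu> * bump c n (x - h) powr (\<alpha> + 1))"
    by (simp add: mult_ac)
  then have "F (bump_grad c n (x - h)) (bump_hess_pos c n (x - h) - bump_hess_neg c n (x - h))
      \<le> - \<mu> * bump c n (x - h) powr (\<alpha> + 1)"
    using \<kappa> by (subst (asm) mult_le_cancel_left_pos) auto
  from bump_estimate[OF F aA \<alpha> n r(1) y nr c_def this] show ?thesis .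
qed

section \<open>The inradius and the passage to the supremum\<close>

text \<open>For positivity the radii must be bounded above, so that \<open>Sup\<close> is an upper
  bound; the diameter of \<Omega> bounds them.\<close>

lemma inradius_approx:
  fixes \<Omega> :: "(real ^ 'n) set"
  assumes "open \<Omega>" "\<Omega> \<noteq> {}"
  shows "r < inradius \<Omega> \<Longrightarrow> \<exists>R x. r < R \<and> ball x R \<subseteq> \<Omega>"
    and "bounded \<Omega> \<Longrightarrow> 0 < inradius \<Omega>"
proof -
  let ?S = "{r. r > 0 \<and> (\<exists>x. ball x r \<subseteq> \<Omega>)}"
  obtain e z where e: "e > 0" "ball z e \<subseteq> \<Omega>" using assms by (metis equals0I open_contains_ball)
  then have ne: "?S \<noteq> {}" by blast
  show "\<exists>R x. r < R \<and> ball x R \<subseteq> \<Omega>" if "r < inradius \<Omega>"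
    using less_cSupD[OF ne that[unfolded inradius_def]] by blast
  assume "bounded \<Omega>"
  have "s \<le> diameter \<Omega>" if s: "s \<in> ?S" for s
  proof -
    obtain x where "0 < s" "ball x s \<subseteq> \<Omega>" using s by blast
    then show ?thesis
      using diameter_subset[OF _ \<open>bounded \<Omega>\<close>, of "ball x s"] by simp
  qed
  then have "bdd_above ?S" by (rule bdd_aboveI)
  then have "e \<le> inradius \<Omega>" unfolding inradius_def using e by (intro cSup_upper) auto
  with e show "0 < inradius \<Omega>" by simp
qed

theorem proposition1p2:
  fixes a A \<alpha> :: real
  assumes "0 < a" and "a \<le> A" and "\<alpha> > -1"
  shows "\<exists>C::real. \<forall>(F :: real ^ 'n \<Rightarrow> real ^ 'n ^ 'n \<Rightarrow> real) (\<Omega> :: (real ^ 'n) set).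
           structure_conditions a A \<alpha> F \<longrightarrow>
           open \<Omega> \<longrightarrow> bounded \<Omega> \<longrightarrow> \<Omega> \<noteq> {} \<longrightarrow>
           lambda_bar F \<alpha> \<Omega> \<le> ereal (C / inradius \<Omega> powr (\<alpha> + 2))"
proof -
  \<comment> \<open>The exponent depends on \<alpha> alone, so \<open>C\<close> depends only on
    \<open>a\<close>, \<open>A\<close>, \<alpha> and the dimension. \<open>Suc k\<close> also
    secures \<open>n \<ge> 1\<close>.\<close>
  obtain k :: nat where k: "1 / (\<alpha> + 1) < real k" using reals_Archimedean2 by blast
  define n where "n = Suc k"
  have "1 < real k * (\<alpha> + 1)" using k \<open>\<alpha> > -1\<close> by (simp add: field_simps)
  also have "\<dots> \<le> (2 * real n + 1) * (\<alpha> + 1)" using \<open>\<alpha> > -1\<close> by (intro mult_right_mono) (auto simp: n_def)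
  finally have n: "n \<ge> 1" "1 \<le> (2 * real n + 1) * (\<alpha> + 1)" by (simp_all add: n_def)
  define C where "C = bound_const a A \<alpha> CARD('n) n"
  show ?thesis
  proof (intro exI[of _ C] allI impI)
    fix F :: "real ^ 'n \<Rightarrow> real ^ 'n ^ 'n \<Rightarrow> real" and \<Omega> :: "(real ^ 'n) set"
    assume F: "structure_conditions a A \<alpha> F" and \<Omega>: "open \<Omega>" "bounded \<Omega>" "\<Omega> \<noteq> {}"
    have R: "0 < inradius \<Omega>" using inradius_approx(2) \<Omega> by blast
    \<comment> \<open>The estimate holds for every positive radius strictly below the inradius;
      letting it increase to the inradius gives the claim.\<close>
    have "\<mu> \<le> C / inradius \<Omega> powr (\<alpha> + 2)" if \<mu>: "\<mu> \<in> admissible_lambdas F \<alpha> \<Omega>" for \<mu>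
    proof (rule tendsto_lowerbound)
      show "((\<lambda>r. C / r powr (\<alpha> + 2)) \<longlongrightarrow> C / inradius \<Omega> powr (\<alpha> + 2)) (at_left (inradius \<Omega>))"
        using R by (intro tendsto_intros) auto
      show "\<forall>\<^sub>F r in at_left (inradius \<Omega>). \<mu> \<le> C / r powr (\<alpha> + 2)"
        using eventually_at_left_real[OF R]
      proof eventually_elim
        case (elim r)
        then obtain R' x where "r < R'" "ball x R' \<subseteq> \<Omega>"
          using inradius_approx(1)[OF \<Omega>(1,3), of r] by auto
        then show ?case
          unfolding C_def using elim assms
          by (intro admissible_le[OF F _ _ \<open>\<alpha> > -1\<close> n \<mu>, of x R']) auto
      qed
    qed auto
    then show "lambda_bar F \<alpha> \<Omega> \<le> ereal (C / inradius \<Omega> powr (\<alpha> + 2))"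
      unfolding lambda_bar_def by (intro SUP_least) auto
  qed
qed

end
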